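(* Let $x^\ast$ be a local minimizer of the MPVC at which MPVC-MFCQ holds. Then $x^\ast$ is an M-stationary point of the MPVC.
   Context: The mathematical program with vanishing constraints (MPVC) is: minimize $f(x)$ over $x\in\mathbb{R}^n$ subject to $g_i(x)\le 0$ ($i=1,\dots,m$), $h_i(x)=0$ ($i=1,\dots,p$), $H_i(x)\ge 0$ and $G_i(x)H_i(x)\le 0$ ($i=1,\dots,q$), where all functions $f,g_i,h_i,G_i,H_i:\mathbb{R}^n\to\mathbb{R}$ are continuously differentiable. Let $\mathcal{C}$ be its feasible set. For $x^\ast\in\mathcal{C}$ put $I_g=\{i: g_i(x^\ast)=0\}$, $I_+=\{i:H_i(x^\ast)>0\}$, $I_{+0}=\{i:H_i(x^\ast)>0,G_i(x^\ast)=0\}$, $I_{+-}=\{i:H_i(x^\ast)>0,G_i(x^\ast)<0\}$, $I_{00}=\{i:H_i(x^\ast)=0,G_i(x^\ast)=0\}$, $I_{0+}=\{i:H_i(x^\ast)=0,G_i(x^\ast)>0\}$, $I_{0-}=\{i:H_i(x^\ast)=0,G_i(x^\ast)<0\}$. MPVC-MFCQ holds at $x^\ast\in\mathcal{C}$ if the gradients $\nabla h_i(x^\ast)$ ($i=1,\dots,p$), $\nabla H_i(x^\ast)$ ($i\in I_{0+}\cup I_{00}$) are linearly independent and there is $d\in\mathbb{R}^n$ with $\nabla h_i(x^\ast)^Td=0$ ($i=1,\dots,p$), $\nabla H_i(x^\ast)^Td=0$ ($i\in I_{0+}\cup I_{00}$), $\nabla g_i(x^\ast)^Td<0$ ($i\in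 I_g$), $\nabla H_i(x^\ast)^Td>0$ ($i\in I_{0-}$), $\nabla G_i(x^\ast)^Td<0$ ($i\in I_{+0}\cup I_{00}$). A feasible point $x^\ast$ is M-stationary if there is $(\lambda,\mu,\eta^G,\eta^H)\in\mathbb{R}^m\times\mathbb{R}^p\times\mathbb{R}^q\times\mathbb{R}^q$ with $$0=\nabla f(x^\ast)+\sum_{i=1}^m\lambda_i\nabla g_i(x^\ast)+\sum_{i=1}^p\mu_i\nabla h_i(x^\ast)+\sum_{i=1}^q\eta_i^G\nabla G_i(x^\ast)-\sum_{i=1}^q\eta_i^H\nabla H_i(x^\ast)$$ and: $\lambda_i\ge0$ for $i\in I_g$, $\lambda_i=0$ for $i\notin I_g$; $\eta_i^G=0$ for $i\in I_{+-}\cup I_{0-}\cup I_{0+}$, $\eta_i^G\ge0$ for $i\in I_{+0}\cup I_{00}$; $\eta_i^H=0$ for $i\in I_+$, $\eta_i^H\ge0$ for $i\in I_{0-}$, $\eta_i^H$ free for $i\in I_{0+}$; $\eta_i^H\eta_i^G=0$ for $i\in I_{00}$. *)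

theory Defs
  imports "HOL-Analysis.Analysis"
begin

definition gradient :: "(real ^ 'n \<Rightarrow> real) \<Rightarrow> real ^ 'n \<Rightarrow> real ^ 'n" where
  "gradient \<phi> x = (THE D. GDERIV \<phi> x :> D)"

definition C1_function :: "(real ^ 'n \<Rightarrow> real) \<Rightarrow> bool" where
  "C1_function \<phi> \<longleftrightarrow> (\<forall>x. \<phi> differentiable at x) \<and> continuous_on UNIV (gradient \<phi>)"

lemma gradient_eqI:
  assumes "GDERIV \<phi> x :> D"
  shows "gradient \<phi> x = D"
  unfolding gradient_def
proof (rule the_equality)
  show "GDERIV \<phi> x :> D" by fact
next
  fix D' assume "GDERIV \<phi> x :> D'"
  then have "(\<lambda>v. v \<bullet> D') = (\<lambda>v. v \<bullet> D)"
    using assms unfolding gderiv_def by (rule has_derivative_unique)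
  then show "D' = D"
    by (metis vector_eq_ldot)
qed

lemma differentiable_imp_GDERIV_gradient:
  assumes "\<phi> differentiable at x"
  shows "GDERIV \<phi> x :> gradient \<phi> x"
proof -
  obtain \<phi>' where d: "(\<phi> has_derivative \<phi>') (at x)"
    using assms unfolding differentiable_def by blast
  then have "linear \<phi>'" by (rule has_derivative_linear)
  then have "\<phi>' = (\<lambda>v. v \<bullet> adjoint \<phi>' 1)"
    by (auto simp: adjoint_works)
  with d have "GDERIV \<phi> x :> adjoint \<phi>' 1"
    unfolding gderiv_def by simp
  then show ?thesis using gradient_eqI by metis
qed

text \<open>
  Linear independence of an indexed family over a finite index set: unlike for
  \<^const>\<open>independent\<close> applied to the set of values, repeated vectors make the family dependent.
\<close>

definition independent_family :: "('i \<Rightarrow> 'v::real_vector) \<Rightarrow> 'i set \<Rightarrow> bool" where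
  "independent_family v J \<longleftrightarrow>
    (\<forall>c. (\<Sum>j\<in>J. c j *\<^sub>R v j) = 0 \<longrightarrow> (\<forall>j\<in>J. c j = 0))"

lemma independent_family_iff:
  assumes J: "finite J"
  shows "independent_family v J \<longleftrightarrow> inj_on v J \<and> independent (v ` J)"
proof
  assume ind: "independent_family v J"
  have inj: "inj_on v J"
  proof (rule inj_onI, rule ccontr)
    fix a b assume ab: "a \<in> J" "b \<in> J" "v a = v b" "a \<noteq> b"
    define c where "c j = (if j = a then 1 else if j = b then - 1 else (0::real))" for j
    have "(\<Sum>j\<in>J. c j *\<^sub>R v j) = (\<Sum>j\<in>{a, b}. c j *\<^sub>R v j)"
      using J ab by (intro sum.mono_neutral_right) (auto simp: c_def)
    also have "\<dots> = 0" using ab by (simp add: c_def)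
    finally have "c a = 0" using ind ab unfolding independent_family_def by blast
    then show False by (simp add: c_def)
  qed
  moreover have "independent (v ` J)"
  proof (rule independent_if_scalars_zero)
    show "finite (v ` J)" using J by simp
    fix u x assume s: "(\<Sum>x\<in>v ` J. u x *\<^sub>R x) = 0" and x: "x \<in> v ` J"
    have "(\<Sum>j\<in>J. u (v j) *\<^sub>R v j) = 0"
      using s by (simp add: sum.reindex[OF inj])
    then have "\<forall>j\<in>J. u (v j) = 0"
      using ind unfolding independent_family_def by (elim allE[of _ "\<lambda>j. u (v j)"]) simp
    then show "u x = 0" using x by auto
  qed
  ultimately show "inj_on v J \<and> independent (v ` J)" by simp
next
  assume R: "inj_on v J \<and> independent (v ` J)"
  show "independent_family v J"
    unfolding independent_family_def
  proof (intro allI impI ballI)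
    fix c j assume s: "(\<Sum>j\<in>J. c j *\<^sub>R v j) = 0" and j: "j \<in> J"
    let ?u = "\<lambda>x. c (inv_into J v x)"
    have "(\<Sum>x\<in>v ` J. ?u x *\<^sub>R x) = (\<Sum>j\<in>J. c j *\<^sub>R v j)"
      using R by (subst sum.reindex) (auto intro!: sum.cong)
    then have "?u (v j) = 0"
      using R s j J independentD[of "v ` J" "v ` J" ?u "v j"] by auto
    then show "c j = 0" using R j by simp
  qed
qed

text \<open>
  The data of an MPVC in \<open>real ^ 'n\<close>.  Constraints are numbered from 1; the values of
  the families outside \<open>{1..nineq}\<close>, \<open>{1..neq}\<close>, \<open>{1..nvan}\<close> are
  irrelevant.
\<close>

record 'n mpvc =
  obj :: "real ^ 'n \<Rightarrow> real"
  nineq :: nat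
  ineq :: "nat \<Rightarrow> real ^ 'n \<Rightarrow> real"
  neq :: nat
  eqc :: "nat \<Rightarrow> real ^ 'n \<Rightarrow> real"
  nvan :: nat
  vanG :: "nat \<Rightarrow> real ^ 'n \<Rightarrow> real"
  vanH :: "nat \<Rightarrow> real ^ 'n \<Rightarrow> real"

definition mpvc_smooth :: "'n::finite mpvc \<Rightarrow> bool" where
  "mpvc_smooth P \<longleftrightarrow>
    C1_function (obj P) \<and>
    (\<forall>i\<in>{1..nineq P}. C1_function (ineq P i)) \<and>
    (\<forall>i\<in>{1..neq P}. C1_function (eqc P i)) \<and>
    (\<forall>i\<in>{1..nvan P}. C1_function (vanG P i) \<and> C1_function (vanH P i))"

definition feasible_set :: "'n::finite mpvc \<Rightarrow> (real ^ 'n) set" where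
  "feasible_set P =
    {x. (\<forall>i\<in>{1..nineq P}. ineq P i x \<le> 0) \<and>
        (\<forall>i\<in>{1..neq P}. eqc P i x = 0) \<and>
        (\<forall>i\<in>{1..nvan P}. vanH P i x \<ge> 0 \<and> vanG P i x * vanH P i x \<le> 0)}"

definition local_minimizer :: "'n::finite mpvc \<Rightarrow> real ^ 'n \<Rightarrow> bool" where
  "local_minimizer P x \<longleftrightarrow>
    x \<in> feasible_set P \<and>
    (\<exists>\<epsilon>>0. \<forall>y\<in>feasible_set P. dist y x < \<epsilon> \<longrightarrow> obj P x \<le> obj P y)"

definition I_g :: "'n::finite mpvc \<Rightarrow> real ^ 'n \<Rightarrow> nat set" where
  "I_g P x = {i\<in>{1..nineq P}. ineq P i x = 0}"

definition I_plus :: "'n::finite mpvc \<Rightarrow> real ^ 'n \<Rightarrow> nat set" where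
  "I_plus P x = {i\<in>{1..nvan P}. vanH P i x > 0}"

definition I_plus_zero :: "'n::finite mpvc \<Rightarrow> real ^ 'n \<Rightarrow> nat set" where
  "I_plus_zero P x = {i\<in>{1..nvan P}. vanH P i x > 0 \<and> vanG P i x = 0}"

definition I_plus_minus :: "'n::finite mpvc \<Rightarrow> real ^ 'n \<Rightarrow> nat set" where
  "I_plus_minus P x = {i\<in>{1..nvan P}. vanH P i x > 0 \<and> vanG P i x < 0}"

definition I_zero_zero :: "'n::finite mpvc \<Rightarrow> real ^ 'n \<Rightarrow> nat set" where
  "I_zero_zero P x = {i\<in>{1..nvan P}. vanH P i x = 0 \<and> vanG P i x = 0}"

definition I_zero_plus :: "'n::finite mpvc \<Rightarrow> real ^ 'n \<Rightarrow> nat set" where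
  "I_zero_plus P x = {i\<in>{1..nvan P}. vanH P i x = 0 \<and> vanG P i x > 0}"

definition I_zero_minus :: "'n::finite mpvc \<Rightarrow> real ^ 'n \<Rightarrow> nat set" where
  "I_zero_minus P x = {i\<in>{1..nvan P}. vanH P i x = 0 \<and> vanG P i x < 0}"

text \<open>
  The gradients of the equality constraints and of the \<open>H\<close>-constraints are combined into one
  family, indexed by a disjoint sum.
\<close>

definition MPVC_MFCQ :: "'n::finite mpvc \<Rightarrow> real ^ 'n \<Rightarrow> bool" where
  "MPVC_MFCQ P x \<longleftrightarrow>
    x \<in> feasible_set P \<and>
    independent_family
      (case_sum (\<lambda>i. gradient (eqc P i) x) (\<lambda>i. gradient (vanH P i) x))
      ({1..neq P} <+> (I_zero_plus P x \<union> I_zero_zero P x)) \<and>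
    (\<exists>d. (\<forall>i\<in>{1..neq P}. gradient (eqc P i) x \<bullet> d = 0) \<and>
         (\<forall>i\<in>I_zero_plus P x \<union> I_zero_zero P x. gradient (vanH P i) x \<bullet> d = 0) \<and>
         (\<forall>i\<in>I_g P x. gradient (ineq P i) x \<bullet> d < 0) \<and>
         (\<forall>i\<in>I_zero_minus P x. gradient (vanH P i) x \<bullet> d > 0) \<and>
         (\<forall>i\<in>I_plus_zero P x \<union> I_zero_zero P x. gradient (vanG P i) x \<bullet> d < 0))"

text \<open>
  Multipliers are functions on \<^typ>\<open>nat\<close> of which only the values at constraint indices matter.
\<close>

definition M_stationary :: "'n::finite mpvc \<Rightarrow> real ^ 'n \<Rightarrow> bool" where
  "M_stationary P x \<longleftrightarrow>
    x \<in> feasible_set P \<and>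
    (\<exists>(\<nu> :: nat \<Rightarrow> real) (\<mu> :: nat \<Rightarrow> real) (\<eta>G :: nat \<Rightarrow> real) (\<eta>H :: nat \<Rightarrow> real).
       0 = gradient (obj P) x
           + (\<Sum>i=1..nineq P. \<nu> i *\<^sub>R gradient (ineq P i) x)
           + (\<Sum>i=1..neq P. \<mu> i *\<^sub>R gradient (eqc P i) x)
           + (\<Sum>i=1..nvan P. \<eta>G i *\<^sub>R gradient (vanG P i) x)
           - (\<Sum>i=1..nvan P. \<eta>H i *\<^sub>R gradient (vanH P i) x) \<and>
       (\<forall>i\<in>I_g P x. \<nu> i \<ge> 0) \<and>
       (\<forall>i\<in>{1..nineq P} - I_g P x. \<nu> i = 0) \<and>
       (\<forall>i\<in>I_plus_minus P x \<union> I_zero_minus P x \<union> I_zero_plus P x. \<eta>G i = 0) \<and>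
       (\<forall>i\<in>I_plus_zero P x \<union> I_zero_zero P x. \<eta>G i \<ge> 0) \<and>
       (\<forall>i\<in>I_plus P x. \<eta>H i = 0) \<and>
       (\<forall>i\<in>I_zero_minus P x. \<eta>H i \<ge> 0) \<and>
       (\<forall>i\<in>I_zero_zero P x. \<eta>H i * \<eta>G i = 0))"

end

theory Submission
  imports Defs
begin

text \<open>
  Fixing \<open>H\<^sub>i = 0\<close> for all biactive indices and dropping the corresponding constraint on \<open>G\<^sub>i\<close> leaves
  an ordinary nonlinear program whose feasible set near \<open>x\<close> is contained in that of the MPVC. So \<open>x\<close>
  minimizes it locally, and MPVC-MFCQ contains the classical MFCQ for it. Its KKT multipliers have
  \<open>\<eta>\<^sup>G = 0\<close> at all biactive indices, hence they are M-stationarity multipliers. The KKT conditions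
  come from the Fritz John conditions, which are the limit of the normalized stationarity conditions
  of the quadratic penalty problems.
\<close>

section \<open>Analytic tools for the penalty method\<close>

text \<open>Bolzano-Weierstrass, one index at a time: each new index costs one further subsequence,
  and limits already obtained survive it. Multipliers are functions on a finite index set rather
  than vectors, so this supplies the compactness for them.\<close>

lemma finite_family_convergent_subseq:
  fixes m :: "nat \<Rightarrow> 'k \<Rightarrow> real"
  assumes "finite K" and "\<And>k. k \<in> K \<Longrightarrow> bounded (range (\<lambda>n. m n k))"
  shows "\<exists>r l. strict_mono r \<and> (\<forall>k\<in>K. (\<lambda>n. m (r n) k) \<longlonglongrightarrow> l k)"
  using assms
proof (induction K rule: finite_induct)
  case empty
  show ?case using strict_mono_id by auto
next
  case (insert a K)
  then obtain r l where r: "strict_mono r" and l: "\<forall>k\<in>K. (\<lambda>n. m (r n) k) \<longlonglongrightarrow> l k"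
    by auto
  have "bounded (range (\<lambda>n. m (r n) a))"
    using insert.prems[of a] by (rule bounded_subset) auto
  then obtain z s where s: "strict_mono (s :: nat \<Rightarrow> nat)" and z: "((\<lambda>n. m (r n) a) \<circ> s) \<longlonglongrightarrow> z"
    using bounded_imp_convergent_subsequence by blast
  have "(\<lambda>n. m ((r \<circ> s) n) k) \<longlonglongrightarrow> (l(a := z)) k" if "k \<in> insert a K" for k
  proof (cases "k = a")
    case True
    then show ?thesis using z by (simp add: o_def)
  next
    case False
    then have "(\<lambda>n. m (r n) k) \<longlonglongrightarrow> l k" using that l by auto
    from LIMSEQ_subseq_LIMSEQ[OF this s] False show ?thesis by (simp add: o_def)
  qed
  then show ?case using strict_mono_o[OF r s] by blast
qed

text \<open>Squaring removes the kink of the positive part: at 0 the difference quotient is bounded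
  by \<open>\<bar>h\<bar>\<close>. This makes the penalty for inequality constraints
  differentiable.\<close>

lemma has_real_derivative_max_0_squared:
  "((\<lambda>t. (max 0 t)\<^sup>2) has_real_derivative 2 * max 0 t) (at (t::real))"
proof -
  consider "t > 0" | "t < 0" | "t = 0" by linarith
  then show ?thesis
  proof cases
    case 1
    have "((\<lambda>t. t\<^sup>2) has_real_derivative 2 * max 0 t) (at t)"
      using 1 by (auto intro!: derivative_eq_intros)
    then show ?thesis
      by (rule has_field_derivative_transform_within_open[where S = "{0<..}"]) (use 1 in auto)
  next
    case 2
    have "((\<lambda>t. 0) has_real_derivative 2 * max 0 t) (at t)"
      using 2 by (auto intro!: derivative_eq_intros)
    then show ?thesis
      by (rule has_field_derivative_transform_within_open[where S = "{..<0}"]) (use 2 in auto)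
  next
    case 3
    have "((\<lambda>h::real. (max 0 h)\<^sup>2 / h) \<longlongrightarrow> 0) (at 0)"
    proof (rule Lim_null_comparison)
      show "\<forall>\<^sub>F h in at 0. norm ((max 0 h)\<^sup>2 / h) \<le> \<bar>h::real\<bar>"
        by (rule always_eventually) (auto simp: max_def power2_eq_square)
      show "((\<lambda>h::real. \<bar>h\<bar>) \<longlongrightarrow> 0) (at 0)"
        by (rule tendsto_rabs_zero[OF tendsto_ident_at])
    qed
    then show ?thesis using 3 by (simp add: has_field_derivative_iff)
  qed
qed

text \<open>Here \<open>r\<close> measures infeasibility and \<open>\<rho> n\<close> is the penalty
  parameter. The proximal term \<open>(dist y x)\<^sup>2\<close> makes \<open>x\<close> the only
  possible limit of the penalty minimizers, although \<open>x\<close> itself need not be a strict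
  minimizer.\<close>

lemma penalty_minimizers:
  fixes f r :: "'a::euclidean_space \<Rightarrow> real"
  assumes cf: "continuous_on UNIV f" and cr: "continuous_on UNIV r"
    and r0: "\<And>y. 0 \<le> r y" and rx: "r x = 0" and \<delta>: "0 < \<delta>"
    and min: "\<And>y. y \<in> cball x \<delta> \<Longrightarrow> r y = 0 \<Longrightarrow> f x \<le> f y"
  shows "\<exists>X \<rho>. X \<longlonglongrightarrow> x \<and>
    (\<forall>n. \<forall>y\<in>cball x \<delta>. f (X n) + (dist (X n) x)\<^sup>2 + \<rho> n * r (X n) \<le> f y + (dist y x)\<^sup>2 + \<rho> n * r y)
    \<and> (\<forall>n. 0 \<le> \<rho> n)"
proof -
  define F where "F n y = f y + (dist y x)\<^sup>2 + real n * r y" for n y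
  have "\<exists>y\<in>cball x \<delta>. \<forall>z\<in>cball x \<delta>. F n y \<le> F n z" for n
  proof (rule continuous_attains_inf)
    show "continuous_on (cball x \<delta>) (F n)"
      unfolding F_def
      by (intro continuous_intros continuous_on_subset[OF cf] continuous_on_subset[OF cr]) auto
  qed (use \<delta> in auto)
  then obtain Y where YB: "\<And>n. Y n \<in> cball x \<delta>"
    and Ymin: "\<And>n z. z \<in> cball x \<delta> \<Longrightarrow> F n (Y n) \<le> F n z"
    by metis
  obtain z s where z: "z \<in> cball x \<delta>" and s: "strict_mono (s :: nat \<Rightarrow> nat)"
    and lim: "(Y \<circ> s) \<longlonglongrightarrow> z"
    using compact_cball[of x \<delta>] YB unfolding compact_def by metis
  have lim: "(\<lambda>n. Y (s n)) \<longlonglongrightarrow> z" using lim by (simp add: o_def)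
  have limf: "(\<lambda>n. f (Y (s n)) + (dist (Y (s n)) x)\<^sup>2) \<longlonglongrightarrow> f z + (dist z x)\<^sup>2"
    by (intro tendsto_intros continuous_on_tendsto_compose[OF cf lim] lim) auto
  have limr: "(\<lambda>n. r (Y (s n))) \<longlonglongrightarrow> r z"
    by (rule continuous_on_tendsto_compose[OF cr lim]) auto
  have Fx: "f (Y n) + (dist (Y n) x)\<^sup>2 + real n * r (Y n) \<le> f x" for n
    using Ymin[of x n] \<delta> rx by (simp add: F_def)
  \<comment> \<open>A lower bound of \<open>f\<close> on the ball bounds the weighted penalty by the
    constant \<open>f x - b\<close>; as the weights tend to infinity, the limit point
    \<open>z\<close> is feasible.\<close>
  obtain b where b: "\<And>y. y \<in> cball x \<delta> \<Longrightarrow> b \<le> f y"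
    using continuous_attains_inf[OF compact_cball, of x \<delta> f] continuous_on_subset[OF cf] \<delta>
    by (metis cball_eq_empty not_less_iff_gr_or_eq top_greatest)
  have "r z \<le> 0"
  proof (rule LIMSEQ_le[OF limr])
    show "(\<lambda>n. (f x - b) / real n) \<longlonglongrightarrow> 0"
      by (rule lim_const_over_n)
    have "r (Y (s n)) \<le> (f x - b) / real n" if "n \<ge> 1" for n
    proof -
      have "real n * r (Y (s n)) \<le> real (s n) * r (Y (s n))"
        using seq_suble[OF s, of n] r0 by (intro mult_right_mono) auto
      also have "\<dots> \<le> f x - b"
        using Fx[of "s n"] b[OF YB[of "s n"]] zero_le_power2[of "dist (Y (s n)) x"] by linarith
      finally show ?thesis using that by (simp add: field_simps)
    qed
    then show "\<exists>N. \<forall>n\<ge>N. r (Y (s n)) \<le> (f x - b) / real n" by blast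
  qed
  \<comment> \<open>Feasibility of \<open>z\<close> gives one inequality between \<open>f x\<close>
    and \<open>f z\<close>. The limit of \<open>Fx\<close> gives the opposite one with the proximal
    term added, so that term must vanish.\<close>
  then have "f x \<le> f z" using min[OF z] r0[of z] by simp
  moreover have "f z + (dist z x)\<^sup>2 \<le> f x"
  proof (rule LIMSEQ_le_const2[OF limf])
    have "f (Y (s n)) + (dist (Y (s n)) x)\<^sup>2 \<le> f x" for n
      using Fx[of "s n"] mult_nonneg_nonneg[of "real (s n)" "r (Y (s n))"] r0[of "Y (s n)"]
      by linarith
    then show "\<exists>N. \<forall>n\<ge>N. f (Y (s n)) + (dist (Y (s n)) x)\<^sup>2 \<le> f x" by blast
  qed
  ultimately have "(dist z x)\<^sup>2 \<le> 0" by linarith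
  then have "z = x" by simp
  with lim Ymin show ?thesis
    by (intro exI[of _ "\<lambda>n. Y (s n)"] exI[of _ "\<lambda>n. real (s n)"]) (auto simp: F_def)
qed

section \<open>Fritz John and KKT conditions for a nonlinear program\<close>

text \<open>The set \<open>E\<close> marks the equality constraints among the active ones.
  Stationarity of the penalty problems, scaled so that the multipliers have absolute sum 1, passes
  to the limit by continuity of the gradients. The normalization also passes to the limit, which
  excludes the trivial multiplier.\<close>

lemma fritz_john:
  fixes f :: "'a::euclidean_space \<Rightarrow> real" and c :: "'k \<Rightarrow> 'a \<Rightarrow> real"
  assumes K: "finite K"
    and f': "\<And>y. GDERIV f y :> f' y" and cf': "continuous_on UNIV f'"
    and c': "\<And>k y. k \<in> K \<Longrightarrow> GDERIV (c k) y :> c' k y"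
    and cc': "\<And>k. k \<in> K \<Longrightarrow> continuous_on UNIV (c' k)"
    and active: "\<And>k. k \<in> K \<Longrightarrow> c k x = 0"
    and min: "\<forall>\<^sub>F y in nhds x.
      (\<forall>k\<in>K \<inter> E. c k y = 0) \<longrightarrow> (\<forall>k\<in>K - E. c k y \<le> 0) \<longrightarrow> f x \<le> f y"
  shows "\<exists>\<alpha> \<mu>. 0 \<le> \<alpha> \<and> (\<forall>k\<in>K - E. 0 \<le> \<mu> k) \<and> \<alpha> + (\<Sum>k\<in>K. \<bar>\<mu> k\<bar>) = 1 \<and>
    \<alpha> *\<^sub>R f' x + (\<Sum>k\<in>K. \<mu> k *\<^sub>R c' k x) = 0"
proof -
  have contf: "continuous_on UNIV f"
    using f' by (auto simp: gderiv_def continuous_on_eq_continuous_at intro: has_derivative_continuous)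
  have contc: "continuous_on UNIV (c k)" if "k \<in> K" for k
    using c'[OF that]
    by (auto simp: gderiv_def continuous_on_eq_continuous_at intro: has_derivative_continuous)
  \<comment> \<open>The violation is signed for equalities and one-sided for inequalities; in both
    cases its square has derivative \<open>2 * \<theta> k t\<close>.\<close>
  define \<theta> where "\<theta> k t = (if k \<in> E then t else max 0 t)" for k :: 'k and t :: real
  have cont\<theta>: "continuous_on UNIV (\<lambda>y. \<theta> k (c k y))" if "k \<in> K" for k
    using contc[OF that] by (cases "k \<in> E") (auto simp: \<theta>_def intro!: continuous_intros)
  have d\<theta>: "((\<lambda>t. (\<theta> k t)\<^sup>2) has_real_derivative 2 * \<theta> k t) (at t)" for k t
    using has_real_derivative_max_0_squared
    by (cases "k \<in> E") (auto simp: \<theta>_def intro!: derivative_eq_intros)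
  define r where "r y = (\<Sum>k\<in>K. (\<theta> k (c k y))\<^sup>2)" for y
  have r_zero: "r y = 0 \<longleftrightarrow> (\<forall>k\<in>K. \<theta> k (c k y) = 0)" for y
    unfolding r_def using K by (subst sum_nonneg_eq_0_iff) auto
  obtain \<epsilon> where \<epsilon>: "0 < \<epsilon>" and min\<epsilon>: "\<And>y. dist y x < \<epsilon> \<Longrightarrow>
      (\<forall>k\<in>K \<inter> E. c k y = 0) \<longrightarrow> (\<forall>k\<in>K - E. c k y \<le> 0) \<longrightarrow> f x \<le> f y"
    using min unfolding eventually_nhds_metric by blast
  \<comment> \<open>Halving makes the closed ball, needed for compactness, fit inside the open ball
    of local minimality.\<close>
  define \<delta> where "\<delta> = \<epsilon> / 2"
  have \<delta>: "0 < \<delta>" using \<epsilon> by (simp add: \<delta>_def)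
  have minr: "f x \<le> f y" if "y \<in> cball x \<delta>" "r y = 0" for y
  proof -
    have "dist y x < \<epsilon>" using that(1) \<epsilon> by (auto simp: \<delta>_def dist_commute)
    moreover have "\<forall>k\<in>K \<inter> E. c k y = 0" "\<forall>k\<in>K - E. c k y \<le> 0"
      using that(2) by (auto simp: r_zero \<theta>_def max_def split: if_splits)
    ultimately show ?thesis using min\<epsilon> by blast
  qed
  have contr: "continuous_on UNIV r"
    unfolding r_def by (intro continuous_intros cont\<theta>)
  have "r x = 0" using active by (auto simp: r_zero \<theta>_def)
  moreover have "0 \<le> r y" for y by (simp add: r_def sum_nonneg)
  ultimately obtain X \<rho> where X: "X \<longlonglongrightarrow> x" and \<rho>: "\<And>n. 0 \<le> \<rho> n"
    and Xmin: "\<And>n y. y \<in> cball x \<delta> \<Longrightarrow>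
      f (X n) + (dist (X n) x)\<^sup>2 + \<rho> n * r (X n) \<le> f y + (dist y x)\<^sup>2 + \<rho> n * r y"
    using penalty_minimizers[OF contf contr _ _ \<delta> minr] by metis
  \<comment> \<open>These are the coefficients of the constraint gradients in the gradient of the
    penalty function at \<open>X n\<close>. They are nonnegative outside \<open>E\<close> but may be
    unbounded in \<open>n\<close>.\<close>
  define a where "a n k = 2 * \<rho> n * \<theta> k (c k (X n))" for n k
  \<comment> \<open>The gradient vanishes only at an interior minimizer, hence the open ball; this
    holds for all large \<open>n\<close> because \<open>X\<close> converges to its centre.\<close>
  have stat: "f' (X n) + 2 *\<^sub>R (X n - x) + (\<Sum>k\<in>K. a n k *\<^sub>R c' k (X n)) = 0"
    if Xn: "X n \<in> ball x \<delta>" for n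
  proof -
    let ?D = "f' (X n) + 2 *\<^sub>R (X n - x) + (\<Sum>k\<in>K. a n k *\<^sub>R c' k (X n))"
    let ?F = "\<lambda>y. f y + (y - x) \<bullet> (y - x) + \<rho> n * (\<Sum>k\<in>K. (\<theta> k (c k y))\<^sup>2)"
    have "((\<lambda>y. (\<theta> k (c k y))\<^sup>2) has_derivative (\<lambda>v. (v \<bullet> c' k (X n)) * (2 * \<theta> k (c k (X n))))) (at (X n))"
      if "k \<in> K" for k
      using has_derivative_compose[OF c'[OF that, of "X n", unfolded gderiv_def]
          d\<theta>[of k "c k (X n)", unfolded has_field_derivative_def]]
      by (simp add: mult.commute)
    then have "((\<lambda>y. \<Sum>k\<in>K. (\<theta> k (c k y))\<^sup>2) has_derivative
        (\<lambda>v. \<Sum>k\<in>K. (v \<bullet> c' k (X n)) * (2 * \<theta> k (c k (X n))))) (at (X n))"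
      by (rule has_derivative_sum)
    moreover have "((\<lambda>y. (y - x) \<bullet> (y - x)) has_derivative (\<lambda>v. v \<bullet> (2 *\<^sub>R (X n - x)))) (at (X n))"
      by (auto intro!: derivative_eq_intros simp: inner_commute)
    ultimately have "(?F has_derivative (\<lambda>v. v \<bullet> f' (X n) + v \<bullet> (2 *\<^sub>R (X n - x))
        + \<rho> n * (\<Sum>k\<in>K. (v \<bullet> c' k (X n)) * (2 * \<theta> k (c k (X n)))))) (at (X n))"
      by (intro has_derivative_add has_derivative_mult_right f'[unfolded gderiv_def])
    also have "(\<lambda>v. v \<bullet> f' (X n) + v \<bullet> (2 *\<^sub>R (X n - x))
        + \<rho> n * (\<Sum>k\<in>K. (v \<bullet> c' k (X n)) * (2 * \<theta> k (c k (X n))))) = (\<lambda>v. v \<bullet> ?D)"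
      by (simp add: fun_eq_iff a_def inner_add_right inner_sum_right sum_distrib_left mult_ac)
    finally have "(?F has_derivative (\<lambda>v. v \<bullet> ?D)) (at (X n))" .
    moreover have "?F y \<ge> ?F (X n)" if "y \<in> ball x \<delta>" for y
      using Xmin[of y n] that by (simp add: r_def dist_norm power2_norm_eq_inner)
    ultimately have "(\<lambda>v. v \<bullet> ?D) = (\<lambda>v. 0)"
      using differential_zero_maxmin[OF Xn open_ball] by blast
    then have "?D \<bullet> ?D = 0" by metis
    then show ?thesis by simp
  qed
  \<comment> \<open>The absolute sum of the multipliers \<open>(1, a n k)\<close>, with 1 belonging
    to the objective; it is at least 1, so dividing by it is safe.\<close>
  define s where "s n = 1 + (\<Sum>k\<in>K. \<bar>a n k\<bar>)" for n
  have s1: "s n \<ge> 1" for n by (simp add: s_def sum_nonneg)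
  \<comment> \<open>\<open>None\<close> stands for the objective and \<open>Some k\<close> for
    constraint \<open>k\<close>, so that a single subsequence serves all normalized
    multipliers.\<close>
  define m where "m n j = (case j of None \<Rightarrow> 1 / s n | Some k \<Rightarrow> a n k / s n)" for n j
  have bnd: "bounded (range (\<lambda>n. m n j))" if "j \<in> insert None (Some ` K)" for j
  proof -
    have "\<bar>m n j\<bar> \<le> 1" for n
    proof (cases j)
      case None
      then show ?thesis using s1[of n] by (simp add: m_def)
    next
      case (Some k)
      then have "\<bar>a n k\<bar> \<le> (\<Sum>k\<in>K. \<bar>a n k\<bar>)"
        using that K by (intro member_le_sum) auto
      then show ?thesis using s1[of n] Some by (simp add: m_def s_def)
    qed
    then show ?thesis by (intro boundedI[of _ 1]) auto
  qed
  have "finite (insert None (Some ` K))" using K by simp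
  from finite_family_convergent_subseq[where m = m, OF this bnd]
  obtain u l where u: "strict_mono (u :: nat \<Rightarrow> nat)"
    and l: "\<forall>j\<in>insert None (Some ` K). (\<lambda>n. m (u n) j) \<longlonglongrightarrow> l j"
    by blast
  define \<alpha> where "\<alpha> = l None"
  define \<mu> where "\<mu> k = l (Some k)" for k
  have lim\<alpha>: "(\<lambda>n. 1 / s (u n)) \<longlonglongrightarrow> \<alpha>"
    using l by (simp add: m_def \<alpha>_def)
  have lim\<mu>: "(\<lambda>n. a (u n) k / s (u n)) \<longlonglongrightarrow> \<mu> k" if "k \<in> K" for k
    using l that by (simp add: m_def \<mu>_def)
  have limX: "(\<lambda>n. X (u n)) \<longlonglongrightarrow> x"
    using LIMSEQ_subseq_LIMSEQ[OF X u] by (simp add: o_def)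
  have "0 \<le> \<alpha>"
    by (rule LIMSEQ_le_const[OF lim\<alpha>]) (use s1 order_trans[OF zero_le_one] in auto)
  moreover have "\<forall>k\<in>K - E. 0 \<le> \<mu> k"
  proof
    fix k assume k: "k \<in> K - E"
    have "0 \<le> a n k / s n" for n
      using k \<rho>[of n] s1[of n] by (auto simp: a_def \<theta>_def)
    then show "0 \<le> \<mu> k"
      using k by (intro LIMSEQ_le_const[OF lim\<mu>]) auto
  qed
  moreover have "\<alpha> + (\<Sum>k\<in>K. \<bar>\<mu> k\<bar>) = 1"
  proof (rule LIMSEQ_unique)
    show "(\<lambda>n. 1 / s (u n) + (\<Sum>k\<in>K. \<bar>a (u n) k / s (u n)\<bar>)) \<longlonglongrightarrow> \<alpha> + (\<Sum>k\<in>K. \<bar>\<mu> k\<bar>)"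
      by (intro tendsto_intros lim\<alpha> lim\<mu>)
    have "1 / s n + (\<Sum>k\<in>K. \<bar>a n k / s n\<bar>) = 1" for n
    proof -
      have "(\<Sum>k\<in>K. \<bar>a n k / s n\<bar>) = (\<Sum>k\<in>K. \<bar>a n k\<bar>) / s n"
        using s1[of n] by (simp add: sum_divide_distrib)
      also have "\<dots> = (s n - 1) / s n" by (simp add: s_def)
      finally show ?thesis using s1[of n] by (simp add: diff_divide_distrib)
    qed
    then show "(\<lambda>n. 1 / s (u n) + (\<Sum>k\<in>K. \<bar>a (u n) k / s (u n)\<bar>)) \<longlonglongrightarrow> 1" by simp
  qed
  moreover have "\<alpha> *\<^sub>R f' x + (\<Sum>k\<in>K. \<mu> k *\<^sub>R c' k x) = 0"
  proof (rule LIMSEQ_unique)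
    \<comment> \<open>The scaled stationarity equation. Its proximal part disappears in the limit
      because \<open>X (u n)\<close> tends to \<open>x\<close> while the factor
      \<open>1 / s (u n)\<close> converges.\<close>
    let ?T = "\<lambda>n. (1 / s (u n)) *\<^sub>R f' (X (u n)) + (1 / s (u n)) *\<^sub>R 2 *\<^sub>R (X (u n) - x)
        + (\<Sum>k\<in>K. (a (u n) k / s (u n)) *\<^sub>R c' k (X (u n)))"
    have "?T \<longlonglongrightarrow> \<alpha> *\<^sub>R f' x + \<alpha> *\<^sub>R 2 *\<^sub>R (x - x) + (\<Sum>k\<in>K. \<mu> k *\<^sub>R c' k x)"
      by (intro tendsto_intros lim\<alpha> lim\<mu> limX continuous_on_tendsto_compose[OF cf' limX]
          continuous_on_tendsto_compose[OF cc' limX]) auto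
    then show "?T \<longlonglongrightarrow> \<alpha> *\<^sub>R f' x + (\<Sum>k\<in>K. \<mu> k *\<^sub>R c' k x)" by simp
    have "\<forall>\<^sub>F n in sequentially. X (u n) \<in> ball x \<delta>"
      using topological_tendstoD[OF limX open_ball] \<delta> by simp
    then have "\<forall>\<^sub>F n in sequentially. ?T n = 0"
    proof eventually_elim
      case (elim n)
      have "?T n = (1 / s (u n)) *\<^sub>R (f' (X (u n)) + 2 *\<^sub>R (X (u n) - x)
          + (\<Sum>k\<in>K. a (u n) k *\<^sub>R c' k (X (u n))))"
        by (simp add: scaleR_add_right scaleR_sum_right)
      also have "\<dots> = 0" by (simp only: stat[OF elim] scaleR_zero_right)
      finally show ?case .
    qed
    then show "?T \<longlonglongrightarrow> 0" by (rule tendsto_eventually)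
  qed
  ultimately show ?thesis by blast
qed

text \<open>If the objective multiplier were 0, pairing the Fritz John equation with
  \<open>d\<close> would leave a vanishing sum of nonpositive terms, so the inequality multipliers
  are 0. Independence then makes the equality multipliers 0, against the normalization. Hence
  \<open>\<alpha>\<close> is positive and can be divided out.\<close>

lemma KKT_MFCQ:
  fixes f :: "'a::euclidean_space \<Rightarrow> real" and c :: "'k \<Rightarrow> 'a \<Rightarrow> real"
  assumes K: "finite K"
    and f': "\<And>y. GDERIV f y :> f' y" "continuous_on UNIV f'"
    and c': "\<And>k y. k \<in> K \<Longrightarrow> GDERIV (c k) y :> c' k y"
      "\<And>k. k \<in> K \<Longrightarrow> continuous_on UNIV (c' k)"
    and active: "\<And>k. k \<in> K \<Longrightarrow> c k x = 0"
    and min: "\<forall>\<^sub>F y in nhds x.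
      (\<forall>k\<in>K \<inter> E. c k y = 0) \<longrightarrow> (\<forall>k\<in>K - E. c k y \<le> 0) \<longrightarrow> f x \<le> f y"
    and indep: "independent_family (\<lambda>k. c' k x) (K \<inter> E)"
    and d: "\<And>k. k \<in> K \<inter> E \<Longrightarrow> c' k x \<bullet> d = 0" "\<And>k. k \<in> K - E \<Longrightarrow> c' k x \<bullet> d < 0"
  shows "\<exists>\<mu>. (\<forall>k\<in>K - E. 0 \<le> \<mu> k) \<and> f' x + (\<Sum>k\<in>K. \<mu> k *\<^sub>R c' k x) = 0"
proof -
  from fritz_john[OF K f' c' active min] obtain \<alpha> \<mu> where
    \<alpha>: "0 \<le> \<alpha>" and \<mu>: "\<forall>k\<in>K - E. 0 \<le> \<mu> k" and one: "\<alpha> + (\<Sum>k\<in>K. \<bar>\<mu> k\<bar>) = 1"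
    and eq: "\<alpha> *\<^sub>R f' x + (\<Sum>k\<in>K. \<mu> k *\<^sub>R c' k x) = 0"
    by blast
  have split: "(\<Sum>k\<in>K. h k) = (\<Sum>k\<in>K \<inter> E. h k) + (\<Sum>k\<in>K - E. h k)" for h :: "'k \<Rightarrow> 'b::comm_monoid_add"
    by (rule sum.Int_Diff[OF K])
  have "\<alpha> \<noteq> 0"
  proof
    assume "\<alpha> = 0"
    with eq have eq0: "(\<Sum>k\<in>K. \<mu> k *\<^sub>R c' k x) = 0" by simp
    then have "(\<Sum>k\<in>K. \<mu> k * (c' k x \<bullet> d)) = 0"
      by (metis (no_types, lifting) inner_scaleR_left inner_sum_left inner_zero_left sum.cong)
    then have "(\<Sum>k\<in>K - E. - (\<mu> k * (c' k x \<bullet> d))) = 0"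
      using d(1) by (simp add: split sum_negf)
    moreover have "0 \<le> - (\<mu> k * (c' k x \<bullet> d))" if "k \<in> K - E" for k
      using \<mu> d(2)[OF that] that by (simp add: mult_nonneg_nonpos)
    ultimately have "\<forall>k\<in>K - E. - (\<mu> k * (c' k x \<bullet> d)) = 0"
      using K by (subst (asm) sum_nonneg_eq_0_iff) auto
    then have z1: "\<forall>k\<in>K - E. \<mu> k = 0" using d(2) by fastforce
    then have "(\<Sum>k\<in>K \<inter> E. \<mu> k *\<^sub>R c' k x) = 0" using eq0 by (simp add: split)
    then have "\<forall>k\<in>K \<inter> E. \<mu> k = 0" using indep unfolding independent_family_def by blast
    with z1 have "(\<Sum>k\<in>K. \<bar>\<mu> k\<bar>) = 0" by (simp add: split)
    with one \<open>\<alpha> = 0\<close> show False by simp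
  qed
  have "f' x + (\<Sum>k\<in>K. (\<mu> k / \<alpha>) *\<^sub>R c' k x)
      = (1 / \<alpha>) *\<^sub>R (\<alpha> *\<^sub>R f' x + (\<Sum>k\<in>K. \<mu> k *\<^sub>R c' k x))"
    using \<open>\<alpha> \<noteq> 0\<close> by (simp add: scaleR_add_right scaleR_sum_right)
  then have "f' x + (\<Sum>k\<in>K. (\<mu> k / \<alpha>) *\<^sub>R c' k x) = 0" using eq by simp
  moreover have "\<forall>k\<in>K - E. 0 \<le> \<mu> k / \<alpha>" using \<mu> \<alpha> by simp
  ultimately show ?thesis by (intro exI[of _ "\<lambda>k. \<mu> k / \<alpha>"]) auto
qed

section \<open>The tightened program near the minimizer\<close>

lemma C1_function_GDERIV: "C1_function \<phi> \<Longrightarrow> GDERIV \<phi> y :> gradient \<phi> y"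
  by (simp add: C1_function_def differentiable_imp_GDERIV_gradient)

lemma C1_function_continuous_gradient: "C1_function \<phi> \<Longrightarrow> continuous_on UNIV (gradient \<phi>)"
  by (simp add: C1_function_def)

lemma C1_function_tendsto: "C1_function \<phi> \<Longrightarrow> (\<phi> \<longlongrightarrow> \<phi> x) (nhds x)"
  unfolding C1_function_def
  by (metis differentiable_imp_continuous_within isCont_def tendsto_at_iff_tendsto_nhds)

text \<open>Strict inequalities at \<open>x\<close> persist nearby by continuity. Where
  \<open>vanH\<close> is held at 0, the product constraint holds whatever the sign of
  \<open>vanG\<close>; at the other indices the factor signs, kept or imposed, make the product
  nonpositive.\<close>

lemma eventually_mem_feasible_set:
  fixes P :: "'n::finite mpvc"
  assumes smooth: "mpvc_smooth P" and x: "x \<in> feasible_set P"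
  shows "\<forall>\<^sub>F y in nhds x.
    (\<forall>i\<in>{1..neq P}. eqc P i y = 0) \<longrightarrow>
    (\<forall>i\<in>I_zero_plus P x \<union> I_zero_zero P x. vanH P i y = 0) \<longrightarrow>
    (\<forall>i\<in>I_g P x. ineq P i y \<le> 0) \<longrightarrow>
    (\<forall>i\<in>I_zero_minus P x. 0 \<le> vanH P i y) \<longrightarrow>
    (\<forall>i\<in>I_plus_zero P x. vanG P i y \<le> 0) \<longrightarrow>
    y \<in> feasible_set P"
proof -
  have "\<forall>\<^sub>F y in nhds x. \<forall>i\<in>{1..nineq P}. ineq P i x < 0 \<longrightarrow> ineq P i y < 0"
    using smooth
    by (intro eventually_ball_finite ballI)
      (auto simp: mpvc_smooth_def intro: order_tendstoD(2)[OF C1_function_tendsto])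
  moreover have "\<forall>\<^sub>F y in nhds x. \<forall>i\<in>{1..nvan P}. 0 < vanH P i x \<longrightarrow> 0 < vanH P i y"
    using smooth
    by (intro eventually_ball_finite ballI)
      (auto simp: mpvc_smooth_def intro: order_tendstoD(1)[OF C1_function_tendsto])
  moreover have "\<forall>\<^sub>F y in nhds x. \<forall>i\<in>{1..nvan P}. vanG P i x < 0 \<longrightarrow> vanG P i y < 0"
    using smooth
    by (intro eventually_ball_finite ballI)
      (auto simp: mpvc_smooth_def intro: order_tendstoD(2)[OF C1_function_tendsto])
  ultimately show ?thesis
  proof eventually_elim
    case (elim y)
    show ?case
    proof (intro impI)
      assume h: "\<forall>i\<in>{1..neq P}. eqc P i y = 0"
        and H0: "\<forall>i\<in>I_zero_plus P x \<union> I_zero_zero P x. vanH P i y = 0"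
        and g: "\<forall>i\<in>I_g P x. ineq P i y \<le> 0"
        and H: "\<forall>i\<in>I_zero_minus P x. 0 \<le> vanH P i y"
        and G: "\<forall>i\<in>I_plus_zero P x. vanG P i y \<le> 0"
      have "ineq P i y \<le> 0" if i: "i \<in> {1..nineq P}" for i
      proof (cases "ineq P i x < 0")
        case True
        then show ?thesis using elim(1) i by fastforce
      next
        case False
        then have "i \<in> I_g P x" using i x by (force simp: feasible_set_def I_g_def)
        then show ?thesis using g by blast
      qed
      moreover have "0 \<le> vanH P i y \<and> vanG P i y * vanH P i y \<le> 0" if i: "i \<in> {1..nvan P}" for i
      proof -
        have Hx: "0 \<le> vanH P i x" "vanG P i x * vanH P i x \<le> 0"
          using x i by (auto simp: feasible_set_def)
        \<comment> \<open>These cases are exhaustive because feasibility of \<open>x\<close>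
          excludes that both factors are positive.\<close>
        consider "i \<in> I_zero_plus P x \<union> I_zero_zero P x" | "i \<in> I_zero_minus P x"
          | "i \<in> I_plus_zero P x" | "i \<in> I_plus_minus P x"
          using i Hx
          unfolding I_zero_plus_def I_zero_zero_def I_zero_minus_def I_plus_zero_def I_plus_minus_def
          by (auto simp: mult_le_0_iff) linarith+
        then show ?thesis
        proof cases
          case 1
          then show ?thesis using H0 by simp
        next
          case 2
          then have "0 \<le> vanH P i y" "vanG P i y < 0"
            using H elim(3) i by (auto simp: I_zero_minus_def)
          then show ?thesis by (simp add: mult_nonpos_nonneg)
        next
          case 3
          then have "0 < vanH P i y" "vanG P i y \<le> 0"
            using G elim(2) i by (auto simp: I_plus_zero_def)
          then show ?thesis by (simp add: mult_nonpos_nonneg)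
        next
          case 4
          then have "0 < vanH P i y" "vanG P i y < 0"
            using elim(2,3) i by (auto simp: I_plus_minus_def)
          then show ?thesis by (simp add: mult_nonpos_nonneg)
        qed
      qed
      ultimately show "y \<in> feasible_set P" using h by (auto simp: feasible_set_def)
    qed
  qed
qed

lemma ball_Plus: "(\<forall>k\<in>A <+> B. Q k) \<longleftrightarrow> (\<forall>a\<in>A. Q (Inl a)) \<and> (\<forall>b\<in>B. Q (Inr b))"
  by auto

section \<open>M-stationarity from the KKT multipliers\<close>

theorem theorem3p3:
  fixes P :: "'n::finite mpvc" and x :: "real ^ 'n"
  assumes "mpvc_smooth P"
    and "local_minimizer P x"
    and "MPVC_MFCQ P x"
  shows "M_stationary P x"
proof -
  note smooth = assms(1)[unfolded mpvc_smooth_def]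
  have x: "x \<in> feasible_set P" using assms(2) by (simp add: local_minimizer_def)
  define J where "J = I_zero_plus P x \<union> I_zero_zero P x"
  \<comment> \<open>\<open>A\<close> indexes the equalities and \<open>B\<close> the inequalities of
    the tightened program, so \<open>range Inl\<close> takes the place of \<open>E\<close> in
    \<open>KKT_MFCQ\<close>. The bounds \<open>0 \<le> vanH P i y\<close> enter \<open>c\<close>
    with a minus sign to have the form \<open>\<le> 0\<close>.\<close>
  define A where "A = {1..neq P} <+> J"
  define B where "B = I_g P x <+> (I_zero_minus P x <+> I_plus_zero P x)"
  define c where "c = case_sum (case_sum (eqc P) (vanH P))
    (case_sum (ineq P) (case_sum (\<lambda>i y. - vanH P i y) (vanG P)))"
  define c' where "c' = case_sum (case_sum (\<lambda>i. gradient (eqc P i)) (\<lambda>i. gradient (vanH P i)))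
    (case_sum (\<lambda>i. gradient (ineq P i))
      (case_sum (\<lambda>i y. - gradient (vanH P i) y) (\<lambda>i. gradient (vanG P i))))"
  note I_defs = I_g_def I_plus_zero_def I_plus_minus_def I_zero_zero_def I_zero_plus_def
    I_zero_minus_def I_plus_def
  have J: "J \<subseteq> {1..nvan P}" and Ig: "I_g P x \<subseteq> {1..nineq P}"
    and Izm: "I_zero_minus P x \<subseteq> {1..nvan P}" and Ipz: "I_plus_zero P x \<subseteq> {1..nvan P}"
    by (auto simp: J_def I_defs)
  note fin = finite_subset[OF J] finite_subset[OF Ig] finite_subset[OF Izm] finite_subset[OF Ipz]
  have finA: "finite A" and finB: "finite B" using fin by (auto simp: A_def B_def)
  have AE: "(A <+> B) \<inter> range Inl = Inl ` A" and BE: "(A <+> B) - range Inl = Inr ` B"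
    by auto
  obtain d where d: "\<forall>i\<in>{1..neq P}. gradient (eqc P i) x \<bullet> d = 0"
      "\<forall>i\<in>J. gradient (vanH P i) x \<bullet> d = 0"
      "\<forall>i\<in>I_g P x. gradient (ineq P i) x \<bullet> d < 0"
      "\<forall>i\<in>I_zero_minus P x. gradient (vanH P i) x \<bullet> d > 0"
      "\<forall>i\<in>I_plus_zero P x. gradient (vanG P i) x \<bullet> d < 0"
    using assms(3) unfolding MPVC_MFCQ_def J_def by blast
  have "\<exists>\<mu>. (\<forall>k\<in>(A <+> B) - range Inl. 0 \<le> \<mu> k) \<and>
    gradient (obj P) x + (\<Sum>k\<in>A <+> B. \<mu> k *\<^sub>R c' k x) = 0"
  proof (rule KKT_MFCQ[where c = c and d = d])
    show "finite (A <+> B)" using finA finB by simp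
    show "GDERIV (obj P) y :> gradient (obj P) y" for y
      using smooth C1_function_GDERIV by blast
    show "continuous_on UNIV (gradient (obj P))"
      using smooth C1_function_continuous_gradient by blast
    show "GDERIV (c k) y :> c' k y" if "k \<in> A <+> B" for k y
      using that smooth J Ig Izm Ipz
      by (auto simp: A_def B_def c_def c'_def intro!: C1_function_GDERIV GDERIV_minus)
    show "continuous_on UNIV (c' k)" if "k \<in> A <+> B" for k
      using that smooth J Ig Izm Ipz
      by (auto simp: A_def B_def c'_def intro!: C1_function_continuous_gradient continuous_on_minus)
    show "c k x = 0" if "k \<in> A <+> B" for k
      using that x by (auto simp: A_def B_def J_def c_def I_defs feasible_set_def)
    show "\<forall>\<^sub>F y in nhds x. (\<forall>k\<in>(A <+> B) \<inter> range Inl. c k y = 0) \<longrightarrow>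
        (\<forall>k\<in>(A <+> B) - range Inl. c k y \<le> 0) \<longrightarrow> obj P x \<le> obj P y"
    proof -
      have "\<forall>\<^sub>F y in nhds x. y \<in> feasible_set P \<longrightarrow> obj P x \<le> obj P y"
        using assms(2) unfolding local_minimizer_def eventually_nhds_metric by blast
      with eventually_mem_feasible_set[OF assms(1) x] show ?thesis
      proof eventually_elim
        case (elim y)
        then show ?case
          unfolding AE BE unfolding A_def B_def J_def c_def by (simp add: ball_Plus ball_Un)
      qed
    qed
    \<comment> \<open>The equality gradients form exactly the family that MPVC-MFCQ declares
      independent.\<close>
    have "(\<lambda>k. c' (Inl k) x) = case_sum (\<lambda>i. gradient (eqc P i) x) (\<lambda>i. gradient (vanH P i) x)"
      by (auto simp: c'_def fun_eq_iff split: sum.split)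
    then have "independent_family (\<lambda>k. c' (Inl k) x) A"
      using assms(3) by (simp add: MPVC_MFCQ_def A_def J_def)
    then show "independent_family (\<lambda>k. c' k x) ((A <+> B) \<inter> range Inl)"
      unfolding AE independent_family_def by (auto simp: sum.reindex o_def)
    show "c' k x \<bullet> d = 0" if "k \<in> (A <+> B) \<inter> range Inl" for k
      using that d unfolding AE by (auto simp: A_def c'_def)
    show "c' k x \<bullet> d < 0" if "k \<in> (A <+> B) - range Inl" for k
      using that d unfolding BE by (auto simp: B_def c'_def)
  qed
  then obtain \<mu> where pos: "\<forall>k\<in>B. 0 \<le> \<mu> (Inr k)"
    and eq: "gradient (obj P) x + (\<Sum>k\<in>A <+> B. \<mu> k *\<^sub>R c' k x) = 0"
    unfolding BE by blast
  define \<nu> where "\<nu> i = (if i \<in> I_g P x then \<mu> (Inr (Inl i)) else 0)" for i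
  \<comment> \<open>Biactive indices get the value 0, since \<open>vanG\<close> is not constrained
    there in the tightened program.\<close>
  define \<eta>G where "\<eta>G i = (if i \<in> I_plus_zero P x then \<mu> (Inr (Inr (Inr i))) else 0)" for i
  \<comment> \<open>M-stationarity subtracts the \<open>vanH\<close> sum: multipliers of the
    equations on \<open>J\<close> change sign, while those of the constraints
    \<open>- vanH P i y \<le> 0\<close> already carry the minus sign. At most one summand is
    nonzero, as \<open>J\<close> and \<open>I_zero_minus P x\<close> are disjoint.\<close>
  define \<eta>H where "\<eta>H i = (if i \<in> J then - \<mu> (Inl (Inr i)) else 0)
    + (if i \<in> I_zero_minus P x then \<mu> (Inr (Inr (Inl i))) else 0)" for i
  have restrict: "(\<Sum>i=1..n. (if i \<in> S then a i else 0) *\<^sub>R v i) = (\<Sum>i\<in>S. a i *\<^sub>R v i)"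
    if "S \<subseteq> {1..n}" for S n and a :: "nat \<Rightarrow> real" and v :: "nat \<Rightarrow> real ^ 'n"
    using that by (intro sum.mono_neutral_cong_right) auto
  have sG: "(\<Sum>i=1..nvan P. \<eta>G i *\<^sub>R gradient (vanG P i) x)
      = (\<Sum>i\<in>I_plus_zero P x. \<mu> (Inr (Inr (Inr i))) *\<^sub>R gradient (vanG P i) x)"
    unfolding \<eta>G_def by (rule restrict[OF Ipz])
  have sg: "(\<Sum>i=1..nineq P. \<nu> i *\<^sub>R gradient (ineq P i) x)
      = (\<Sum>i\<in>I_g P x. \<mu> (Inr (Inl i)) *\<^sub>R gradient (ineq P i) x)"
    unfolding \<nu>_def by (rule restrict[OF Ig])
  have sH: "(\<Sum>i=1..nvan P. \<eta>H i *\<^sub>R gradient (vanH P i) x)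
      = (\<Sum>i\<in>J. (- \<mu> (Inl (Inr i))) *\<^sub>R gradient (vanH P i) x)
        + (\<Sum>i\<in>I_zero_minus P x. \<mu> (Inr (Inr (Inl i))) *\<^sub>R gradient (vanH P i) x)"
    unfolding \<eta>H_def scaleR_add_left sum.distrib restrict[OF J] restrict[OF Izm] ..
  have expand: "(\<Sum>k\<in>A <+> B. \<mu> k *\<^sub>R c' k x)
      = (\<Sum>i=1..neq P. \<mu> (Inl (Inl i)) *\<^sub>R gradient (eqc P i) x)
        + (\<Sum>i\<in>J. \<mu> (Inl (Inr i)) *\<^sub>R gradient (vanH P i) x)
        + ((\<Sum>i\<in>I_g P x. \<mu> (Inr (Inl i)) *\<^sub>R gradient (ineq P i) x)
        + ((\<Sum>i\<in>I_zero_minus P x. - (\<mu> (Inr (Inr (Inl i))) *\<^sub>R gradient (vanH P i) x))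
        + (\<Sum>i\<in>I_plus_zero P x. \<mu> (Inr (Inr (Inr i))) *\<^sub>R gradient (vanG P i) x)))"
    using fin finA finB by (simp add: A_def B_def sum.Plus c'_def)
  have "0 = gradient (obj P) x
      + (\<Sum>i=1..nineq P. \<nu> i *\<^sub>R gradient (ineq P i) x)
      + (\<Sum>i=1..neq P. \<mu> (Inl (Inl i)) *\<^sub>R gradient (eqc P i) x)
      + (\<Sum>i=1..nvan P. \<eta>G i *\<^sub>R gradient (vanG P i) x)
      - (\<Sum>i=1..nvan P. \<eta>H i *\<^sub>R gradient (vanH P i) x)"
    using eq[unfolded expand] unfolding sG sg sH by (simp add: sum_negf algebra_simps)
  moreover have "\<forall>i\<in>I_g P x. \<nu> i \<ge> 0" "\<forall>i\<in>{1..nineq P} - I_g P x. \<nu> i = 0"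
    using pos by (auto simp: \<nu>_def B_def)
  moreover have "\<forall>i\<in>I_plus_minus P x \<union> I_zero_minus P x \<union> I_zero_plus P x. \<eta>G i = 0"
    by (auto simp: \<eta>G_def I_defs)
  moreover have "\<forall>i\<in>I_plus_zero P x \<union> I_zero_zero P x. \<eta>G i \<ge> 0"
    using pos by (auto simp: \<eta>G_def B_def)
  moreover have "\<forall>i\<in>I_plus P x. \<eta>H i = 0"
    by (auto simp: \<eta>H_def J_def I_defs)
  moreover have "\<forall>i\<in>I_zero_minus P x. \<eta>H i \<ge> 0"
    \<comment> \<open>The second \<open>auto\<close> rules out an index of
      \<open>I_zero_minus P x\<close> in \<open>J\<close>, where the sign of the multiplier would be
      unknown.\<close>
    using pos by (auto simp: \<eta>H_def J_def B_def) (auto simp: I_defs)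
  moreover have "\<forall>i\<in>I_zero_zero P x. \<eta>H i * \<eta>G i = 0"
    by (auto simp: \<eta>G_def I_defs)
  ultimately show ?thesis
    unfolding M_stationary_def using x
    by (intro conjI exI[of _ \<nu>] exI[of _ "\<lambda>i. \<mu> (Inl (Inl i))"] exI[of _ \<eta>G] exI[of _ \<eta>H]) simp_all
qed

end
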